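(* Let $(X,d)$ be a compact metric space and let $\mathbb{F}=\{f_1,f_2,\dots,f_n\}$ be a finite family of continuous surjective maps $f_i:X\to X$ that is commutative, i.e. $f_i\circ f_j=f_j\circ f_i$ for all $i,j\in\{1,\dots,n\}$. Then the non-autonomous system $(X,\mathbb{F})$ is weakly mixing if and only if the autonomous system $(X,\,f_n\circ f_{n-1}\circ\cdots\circ f_1)$ is weakly mixing.
   Context: The non-autonomous system generated by the finite ordered family $\mathbb{F}=\{f_1,\dots,f_n\}$ is obtained by repeating the maps cyclically: for every $k\ge1$ put $f_k=f_{1+((k-1)\bmod n)}$, and let $\omega_k=f_k\circ f_{k-1}\circ\cdots\circ f_1$. The system $(X,\mathbb{F})$ is weakly mixing if for any non-empty open sets $U_1,U_2,V_1,V_2\subseteq X$ there exists a positive integer $k$ such that $\omega_k(U_i)\cap V_i\neq\emptyset$ for $i=1,2$. An autonomous system $(X,g)$ is weakly mixing if for any such sets there exists a positive integer $k$ with $g^k(U_i)\cap V_i\neq\emptyset$ for $i=1,2$. *)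

theory Defs
  imports "HOL-Analysis.Analysis"
begin

text \<open>Families and sequences of maps are functions on \<^typ>\<open>nat\<close> that are used only at
  indices \<open>\<ge> 1\<close>.\<close>

text \<open>The cyclic repetition of a finite family \<open>f 1, \<dots>, f n\<close>, for \<open>k \<ge> 1\<close> and \<open>n \<ge> 1\<close>.\<close>

definition cyclic_seq :: "nat \<Rightarrow> (nat \<Rightarrow> 'a \<Rightarrow> 'a) \<Rightarrow> nat \<Rightarrow> 'a \<Rightarrow> 'a" where
  "cyclic_seq n f k = f (1 + (k - 1) mod n)"

text \<open>\<open>comp_upto f k = f k \<circ> f (k - 1) \<circ> \<dots> \<circ> f 1\<close>\<close>

primrec comp_upto :: "(nat \<Rightarrow> 'a \<Rightarrow> 'a) \<Rightarrow> nat \<Rightarrow> 'a \<Rightarrow> 'a" where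
  "comp_upto f 0 = id"
| "comp_upto f (Suc k) = f (Suc k) \<circ> comp_upto f k"

definition nonautonomous_weakly_mixing :: "'a topology \<Rightarrow> (nat \<Rightarrow> 'a \<Rightarrow> 'a) \<Rightarrow> bool" where
  "nonautonomous_weakly_mixing T f \<longleftrightarrow>
     (\<forall>U1 U2 V1 V2.
        openin T U1 \<and> U1 \<noteq> {} \<and> openin T U2 \<and> U2 \<noteq> {} \<and>
        openin T V1 \<and> V1 \<noteq> {} \<and> openin T V2 \<and> V2 \<noteq> {} \<longrightarrow>
        (\<exists>k>0. comp_upto f k ` U1 \<inter> V1 \<noteq> {} \<and> comp_upto f k ` U2 \<inter> V2 \<noteq> {}))"

definition autonomous_weakly_mixing :: "'a topology \<Rightarrow> ('a \<Rightarrow> 'a) \<Rightarrow> bool" where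
  "autonomous_weakly_mixing T g \<longleftrightarrow>
     (\<forall>U1 U2 V1 V2.
        openin T U1 \<and> U1 \<noteq> {} \<and> openin T U2 \<and> U2 \<noteq> {} \<and>
        openin T V1 \<and> V1 \<noteq> {} \<and> openin T V2 \<and> V2 \<noteq> {} \<longrightarrow>
        (\<exists>k>0. (g ^^ k) ` U1 \<inter> V1 \<noteq> {} \<and> (g ^^ k) ` U2 \<inter> V2 \<noteq> {}))"

end

theory Submission
  imports Defs
begin

text \<open>Write \<open>\<omega>\<^sub>m = f\<^sub>m \<circ> \<dots> \<circ> f\<^sub>1\<close> (indices cyclic modulo \<open>n\<close>), \<open>N(U, V) = {m. \<omega>\<^sub>m(U) \<inter> V \<noteq> {}}\<close>
  and \<open>g = f\<^sub>n \<circ> \<dots> \<circ> f\<^sub>1\<close>. Since \<open>\<omega>\<^sub>n\<^sub>q = g\<^sup>q\<close>, weak mixing of \<open>g\<close>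
  is weak mixing of the family along multiples of \<open>n\<close>. Conversely, Furstenberg's argument applies
  to the commuting maps \<open>\<omega>\<^sub>m\<close>: any two sets \<open>N(U\<^sub>1, V\<^sub>1)\<close>, \<open>N(U\<^sub>2, V\<^sub>2)\<close> contain a common \<open>N(U, V)\<close>, so
  finitely many of them always have a common element. Apply this to the preimages
  \<open>V\<^sub>r = (f\<^sub>n \<circ> \<dots> \<circ> f\<^sub>r\<^sub>+\<^sub>1)\<^sup>-\<^sup>1(V)\<close> for \<open>r < n\<close>, nonempty by surjectivity: whatever the residue of the common
  hitting time modulo \<open>n\<close>, completing the current cycle gives a positive multiple of \<open>n\<close> in \<open>N(U, V)\<close>.\<close>

lemma comp_upto_cong:
  "(\<And>i. 1 \<le> i \<Longrightarrow> i \<le> k \<Longrightarrow> f i = g i) \<Longrightarrow> comp_upto f k = comp_upto g k"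
  by (induction k) auto

lemma comp_upto_add:
  "comp_upto f (k + m) = comp_upto (\<lambda>i. f (k + i)) m \<circ> comp_upto f k"
  by (induction m) (auto simp: comp_assoc)

lemma continuous_map_comp_upto:
  "(\<And>i. continuous_map T T (f i)) \<Longrightarrow> continuous_map T T (comp_upto f k)"
  by (induction k) (auto simp del: id_apply intro: continuous_map_compose)

lemma image_comp_upto:
  "(\<And>i. f i ` X = X) \<Longrightarrow> comp_upto f k ` X = X"
  by (induction k) (simp_all only: comp_upto.simps image_comp [symmetric] image_id id_apply)

text \<open>A single map is first moved past a whole composition, then the maps of the other
  composition are moved one at a time. Commutation is only available on \<open>X\<close>, so
  intermediate points must stay in \<open>X\<close>.\<close>

lemma comp_upto_commute:
  assumes maps: "\<And>i. f i ` X \<subseteq> X"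
    and comm: "\<And>i j x. x \<in> X \<Longrightarrow> f i (f j x) = f j (f i x)"
    and x: "x \<in> X"
  shows "comp_upto f k (comp_upto f m x) = comp_upto f m (comp_upto f k x)"
proof -
  have in_X: "comp_upto f k x \<in> X" if "x \<in> X" for k x
    using that maps by (induction k) auto
  have step: "f i (comp_upto f k x) = comp_upto f k (f i x)" if "x \<in> X" for i k x
    using that
  proof (induction k)
    case (Suc k)
    then show ?case using comm [OF in_X, of x i "Suc k" k] by simp
  qed simp
  show ?thesis
  proof (induction k)
    case (Suc k)
    then show ?case using step in_X x by simp
  qed simp
qed

lemma cyclic_seq_add_mult: "i \<ge> 1 \<Longrightarrow> cyclic_seq n f (n * q + i) = cyclic_seq n f i"
proof -
  assume "i \<ge> 1"
  \<comment> \<open>Truncated subtraction makes \<open>i \<ge> 1\<close> matter here.\<close>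
  then have "n * q + i - 1 = i - 1 + n * q" by simp
  then show ?thesis by (simp add: cyclic_seq_def del: add_diff_assoc)
qed

lemma comp_upto_cyclic_seq_mult:
  "comp_upto (cyclic_seq n f) (n * q) = comp_upto f n ^^ q"
proof (induction q)
  case (Suc q)
  have "comp_upto (\<lambda>i. cyclic_seq n f (n * q + i)) n = comp_upto f n"
    by (rule comp_upto_cong, subst cyclic_seq_add_mult) (auto simp: cyclic_seq_def)
  then show ?case
    using Suc comp_upto_add [of "cyclic_seq n f" "n * q" n] by (simp add: add.commute)
qed simp

text \<open>After \<open>k\<close> maps the current cycle lacks its last \<open>n - k mod n\<close>
  maps. If \<open>n\<close> divides \<open>k\<close>, a whole further cycle is appended, so the
  exponent is positive in every case.\<close>

lemma comp_upto_cyclic_seq_complete: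
  assumes "n \<ge> 1"
  shows "comp_upto (\<lambda>i. cyclic_seq n f (k mod n + i)) (n - k mod n) \<circ> comp_upto (cyclic_seq n f) k
    = comp_upto f n ^^ Suc (k div n)"
proof -
  let ?r = "k mod n" and ?q = "k div n"
  have "comp_upto (\<lambda>i. cyclic_seq n f (?r + i)) (n - ?r)
      = comp_upto (\<lambda>i. cyclic_seq n f (k + i)) (n - ?r)"
  proof (rule comp_upto_cong)
    fix i :: nat
    assume "1 \<le> i"
    then have "cyclic_seq n f (n * ?q + (?r + i)) = cyclic_seq n f (?r + i)"
      by (intro cyclic_seq_add_mult) simp
    then show "cyclic_seq n f (?r + i) = cyclic_seq n f (k + i)"
      by (simp flip: add.assoc)
  qed
  moreover have "k + (n - ?r) = n * Suc ?q"
  proof -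
    have "?r < n" using assms by simp
    then show ?thesis using mult_div_mod_eq [of n k] unfolding mult_Suc_right by linarith
  qed
  ultimately show ?thesis
    by (metis comp_upto_add comp_upto_cyclic_seq_mult)
qed

definition hitting_times :: "(nat \<Rightarrow> 'a \<Rightarrow> 'a) \<Rightarrow> 'a set \<Rightarrow> 'a set \<Rightarrow> nat set" where
  "hitting_times f U V = {m. comp_upto f m ` U \<inter> V \<noteq> {}}"

lemma hitting_times_directed:
  assumes cont: "\<And>i. continuous_map T T (f i)"
    and comm: "\<And>i j x. x \<in> topspace T \<Longrightarrow> f i (f j x) = f j (f i x)"
    and mixing: "nonautonomous_weakly_mixing T f"
    and U1: "openin T U1" "U1 \<noteq> {}" and V1: "openin T V1" "V1 \<noteq> {}"
    and U2: "openin T U2" "U2 \<noteq> {}" and V2: "openin T V2" "V2 \<noteq> {}"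
  obtains U V where "openin T U" "U \<noteq> {}" "openin T V" "V \<noteq> {}"
    "hitting_times f U V \<subseteq> hitting_times f U1 V1 \<inter> hitting_times f U2 V2"
proof -
  \<comment> \<open>Furstenberg's choice of pairs: mixing is applied from \<open>U1\<close> to
    \<open>U2\<close> and from \<open>V1\<close> to \<open>V2\<close>, not from each
    \<open>U\<close> to its \<open>V\<close>.\<close>
  obtain k where k: "comp_upto f k ` U1 \<inter> U2 \<noteq> {}" "comp_upto f k ` V1 \<inter> V2 \<noteq> {}"
    using mixing U1 U2 V1 V2 unfolding nonautonomous_weakly_mixing_def by meson
  note cont_k = continuous_map_comp_upto [of T f k, OF cont]
  define U where "U = U1 \<inter> {x \<in> topspace T. comp_upto f k x \<in> U2}"
  define V where "V = V1 \<inter> {x \<in> topspace T. comp_upto f k x \<in> V2}"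
  show thesis
  proof (rule that)
    show "openin T U" "openin T V"
      using cont_k U1 U2 V1 V2 unfolding U_def V_def
      by (auto intro: openin_continuous_map_preimage)
    show "U \<noteq> {}" "V \<noteq> {}"
      using k openin_subset [OF U1(1)] openin_subset [OF V1(1)] unfolding U_def V_def by blast+
    show "hitting_times f U V \<subseteq> hitting_times f U1 V1 \<inter> hitting_times f U2 V2"
    proof
      fix m
      assume "m \<in> hitting_times f U V"
      then obtain x where x: "x \<in> U" "comp_upto f m x \<in> V"
        unfolding hitting_times_def by blast
      \<comment> \<open>The point \<open>x\<close> itself witnesses \<open>m\<close> for the first
        pair, and \<open>comp_upto f k x\<close> witnesses it for the second: by commutation its
        image at time \<open>m\<close> lies in \<open>V2\<close>.\<close>
      have "comp_upto f k (comp_upto f m x) = comp_upto f m (comp_upto f k x)"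
      proof (rule comp_upto_commute)
        show "f i ` topspace T \<subseteq> topspace T" for i
          using cont by (rule continuous_map_image_subset_topspace)
      qed (use comm x in \<open>auto simp: U_def\<close>)
      then show "m \<in> hitting_times f U1 V1 \<inter> hitting_times f U2 V2"
        using x unfolding U_def V_def hitting_times_def by auto
    qed
  qed
qed

lemma finite_hitting_times_common:
  assumes cont: "\<And>i. continuous_map T T (f i)"
    and comm: "\<And>i j x. x \<in> topspace T \<Longrightarrow> f i (f j x) = f j (f i x)"
    and mixing: "nonautonomous_weakly_mixing T f"
    and I: "finite I" "I \<noteq> {}"
    and U: "\<And>i. i \<in> I \<Longrightarrow> openin T (U i) \<and> U i \<noteq> {}"
    and V: "\<And>i. i \<in> I \<Longrightarrow> openin T (V i) \<and> V i \<noteq> {}"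
  obtains k where "k > 0" "\<And>i. i \<in> I \<Longrightarrow> k \<in> hitting_times f (U i) (V i)"
proof -
  have "\<exists>U' V'. openin T U' \<and> U' \<noteq> {} \<and> openin T V' \<and> V' \<noteq> {} \<and>
      hitting_times f U' V' \<subseteq> (\<Inter>i\<in>I. hitting_times f (U i) (V i))"
    using I U V
  proof (induction I rule: finite_ne_induct)
    case (singleton i)
    then show ?case by (intro exI [of _ "U i"] exI [of _ "V i"]) simp
  next
    case (insert i I)
    have "\<exists>U' V'. openin T U' \<and> U' \<noteq> {} \<and> openin T V' \<and> V' \<noteq> {} \<and>
        hitting_times f U' V' \<subseteq> (\<Inter>i\<in>I. hitting_times f (U i) (V i))"
      by (rule insert.IH) (simp_all add: insert.prems)
    then obtain U' V' where *: "openin T U'" "U' \<noteq> {}" "openin T V'" "V' \<noteq> {}"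
      "hitting_times f U' V' \<subseteq> (\<Inter>i\<in>I. hitting_times f (U i) (V i))"
      by (elim exE conjE)
    have i: "openin T (U i)" "U i \<noteq> {}" "openin T (V i)" "V i \<noteq> {}"
      by (simp_all add: insert.prems)
    obtain U'' V'' where **: "openin T U''" "U'' \<noteq> {}" "openin T V''" "V'' \<noteq> {}"
      "hitting_times f U'' V'' \<subseteq> hitting_times f (U i) (V i) \<inter> hitting_times f U' V'"
      by (rule hitting_times_directed [OF cont comm mixing i *(1-4)])
    have "hitting_times f U'' V'' \<subseteq> (\<Inter>i\<in>insert i I. hitting_times f (U i) (V i))"
      using *(5) **(5) by auto
    with **(1-4) show ?case by (intro exI conjI)
  qed
  then obtain U' V' where *: "openin T U'" "U' \<noteq> {}" "openin T V'" "V' \<noteq> {}"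
    "hitting_times f U' V' \<subseteq> (\<Inter>i\<in>I. hitting_times f (U i) (V i))"
    by (elim exE conjE)
  \<comment> \<open>Mixing with the same pair taken twice supplies a positive time.\<close>
  have "\<exists>k>0. comp_upto f k ` U' \<inter> V' \<noteq> {} \<and> comp_upto f k ` U' \<inter> V' \<noteq> {}"
    by (rule mixing [unfolded nonautonomous_weakly_mixing_def, rule_format]) (simp add: *)
  then obtain k where "k > 0" "k \<in> hitting_times f U' V'"
    unfolding hitting_times_def by blast
  then show thesis using *(5) by (intro that) auto
qed

lemma weakly_mixing_cyclic_seq_iff:
  fixes T :: "'a topology"
  assumes n: "n \<ge> 1"
    and cont: "\<And>i. i \<in> {1..n} \<Longrightarrow> continuous_map T T (f i)"
    and surj: "\<And>i. i \<in> {1..n} \<Longrightarrow> f i ` topspace T = topspace T"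
    and comm: "\<And>i j x. i \<in> {1..n} \<Longrightarrow> j \<in> {1..n} \<Longrightarrow> x \<in> topspace T \<Longrightarrow> f i (f j x) = f j (f i x)"
  shows "nonautonomous_weakly_mixing T (cyclic_seq n f) \<longleftrightarrow>
         autonomous_weakly_mixing T (comp_upto f n)"
proof
  assume mixing: "autonomous_weakly_mixing T (comp_upto f n)"
  show "nonautonomous_weakly_mixing T (cyclic_seq n f)"
    unfolding nonautonomous_weakly_mixing_def
  proof (intro allI impI)
    fix U1 U2 V1 V2
    assume "openin T U1 \<and> U1 \<noteq> {} \<and> openin T U2 \<and> U2 \<noteq> {} \<and>
      openin T V1 \<and> V1 \<noteq> {} \<and> openin T V2 \<and> V2 \<noteq> {}"
    then have "\<exists>q>0. comp_upto (cyclic_seq n f) (n * q) ` U1 \<inter> V1 \<noteq> {} \<and>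
        comp_upto (cyclic_seq n f) (n * q) ` U2 \<inter> V2 \<noteq> {}"
      unfolding comp_upto_cyclic_seq_mult
      by (rule mixing [unfolded autonomous_weakly_mixing_def, rule_format])
    then obtain q where "q > 0" "comp_upto (cyclic_seq n f) (n * q) ` U1 \<inter> V1 \<noteq> {}"
        "comp_upto (cyclic_seq n f) (n * q) ` U2 \<inter> V2 \<noteq> {}"
      by (elim exE conjE)
    moreover from \<open>q > 0\<close> n have "n * q > 0" by simp
    ultimately show "\<exists>k>0. comp_upto (cyclic_seq n f) k ` U1 \<inter> V1 \<noteq> {} \<and>
        comp_upto (cyclic_seq n f) k ` U2 \<inter> V2 \<noteq> {}"
      by (intro exI conjI)
  qed
next
  assume mixing: "nonautonomous_weakly_mixing T (cyclic_seq n f)"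
  let ?F = "cyclic_seq n f"
  have index: "1 + (k - 1) mod n \<in> {1..n}" for k
    using n by (simp add: Suc_le_eq)
  have contF: "continuous_map T T (?F k)" for k
    unfolding cyclic_seq_def by (rule cont [OF index])
  have surjF: "?F k ` topspace T = topspace T" for k
    unfolding cyclic_seq_def by (rule surj [OF index])
  have commF: "?F i (?F j x) = ?F j (?F i x)" if "x \<in> topspace T" for i j x
    unfolding cyclic_seq_def by (rule comm [OF index index that])
  \<comment> \<open>\<open>tail r\<close> finishes a cycle of which \<open>r\<close> maps have been
    applied; \<open>tail 0\<close> is a full cycle.\<close>
  define tail where "tail r = comp_upto (\<lambda>i. ?F (r + i)) (n - r)" for r
  have cont_tail: "continuous_map T T (tail r)" for r
    unfolding tail_def by (intro continuous_map_comp_upto contF)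
  have surj_tail: "tail r ` topspace T = topspace T" for r
    unfolding tail_def by (intro image_comp_upto surjF)
  show "autonomous_weakly_mixing T (comp_upto f n)"
    unfolding autonomous_weakly_mixing_def
  proof (intro allI impI, elim conjE)
    fix U1 U2 V1 V2
    assume U1: "openin T U1" "U1 \<noteq> {}" and U2: "openin T U2" "U2 \<noteq> {}"
      and V1: "openin T V1" "V1 \<noteq> {}" and V2: "openin T V2" "V2 \<noteq> {}"
    \<comment> \<open>The index \<open>p\<close> pairs a residue with a choice between the two
      target conditions. The residue of the hitting time is not known in advance, so all
      \<open>2 * n\<close> conditions are imposed at once.\<close>
    define U where "U p = (if snd p then U1 else U2)" for p :: "nat \<times> bool"
    define V where "V p = {x \<in> topspace T. tail (fst p) x \<in> (if snd p then V1 else V2)}"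
      for p :: "nat \<times> bool"
    have V_nonempty: "openin T (V p) \<and> V p \<noteq> {}" for p
    proof
      let ?W = "if snd p then V1 else V2"
      have W: "openin T ?W" "?W \<noteq> {}" using V1 V2 by auto
      show "openin T (V p)"
        unfolding V_def using cont_tail W(1) by (rule openin_continuous_map_preimage)
      \<comment> \<open>A point of the target has a preimage because \<open>tail\<close> is
        onto.\<close>
      obtain y where y: "y \<in> ?W" using W(2) by blast
      then have "y \<in> tail (fst p) ` topspace T"
        using openin_subset [OF W(1)] surj_tail by blast
      then show "V p \<noteq> {}" using y unfolding V_def by blast
    qed
    obtain k where k: "\<And>p. p \<in> {..<n} \<times> UNIV \<Longrightarrow> k \<in> hitting_times ?F (U p) (V p)"
    proof (rule finite_hitting_times_common [OF contF commF mixing, where U = U and V = V])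
      show "finite ({..<n} \<times> (UNIV :: bool set))" by simp
      show "{..<n} \<times> (UNIV :: bool set) \<noteq> {}" using n by (auto simp: lessThan_empty_iff)
      show "openin T (U p) \<and> U p \<noteq> {}" for p using U1 U2 by (simp add: U_def)
    qed (use V_nonempty in auto)
    have complete: "tail (k mod n) (comp_upto ?F k x) = (comp_upto f n ^^ Suc (k div n)) x" for x
      using comp_upto_cyclic_seq_complete [OF n, of f k] unfolding tail_def by (metis comp_apply)
    \<comment> \<open>Only the residue \<open>k mod n\<close> is now used. Both values of
      \<open>b\<close> share the same \<open>k\<close>, hence the same power of the composed
      map.\<close>
    have "(comp_upto f n ^^ Suc (k div n)) ` U (k mod n, b) \<inter> (if b then V1 else V2) \<noteq> {}" for b
    proof -
      have "(k mod n, b) \<in> {..<n} \<times> UNIV" using n by simp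
      then obtain x where x: "x \<in> U (k mod n, b)" "comp_upto ?F k x \<in> V (k mod n, b)"
        using k [of "(k mod n, b)"] unfolding hitting_times_def by blast
      then have "(comp_upto f n ^^ Suc (k div n)) x \<in> (if b then V1 else V2)"
        unfolding V_def complete [symmetric] by simp
      then show ?thesis using x(1) by blast
    qed
    from this [of True] this [of False]
    show "\<exists>k>0. (comp_upto f n ^^ k) ` U1 \<inter> V1 \<noteq> {} \<and> (comp_upto f n ^^ k) ` U2 \<inter> V2 \<noteq> {}"
      unfolding U_def by (intro exI [of _ "Suc (k div n)"]) (simp del: funpow.simps)
  qed
qed

theorem lemma10:
  fixes X :: "'a set" and d :: "'a \<Rightarrow> 'a \<Rightarrow> real"
    and n :: nat and f :: "nat \<Rightarrow> 'a \<Rightarrow> 'a"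
  assumes "Metric_space X d"
    and "compact_space (Metric_space.mtopology X d)"
    and "n \<ge> 1"
    and "\<And>i. i \<in> {1..n} \<Longrightarrow>
           continuous_map (Metric_space.mtopology X d) (Metric_space.mtopology X d) (f i)"
    and "\<And>i. i \<in> {1..n} \<Longrightarrow> f i ` X = X"
    and "\<And>i j x. i \<in> {1..n} \<Longrightarrow> j \<in> {1..n} \<Longrightarrow> x \<in> X \<Longrightarrow> f i (f j x) = f j (f i x)"
  shows "nonautonomous_weakly_mixing (Metric_space.mtopology X d) (cyclic_seq n f) \<longleftrightarrow>
         autonomous_weakly_mixing (Metric_space.mtopology X d) (comp_upto f n)"
proof -
  interpret Metric_space X d by fact
  show ?thesis
    using assms(3-6) by (intro weakly_mixing_cyclic_seq_iff) (simp_all add: assms(4))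
qed

end
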